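(* There is a constant value of $\epsilon>0$ for which finding an $\epsilon$-Nash equilibrium of a $k\times k$ bimatrix game requires strictly more than $2k-1$ payoff queries.
   Context: A $k\times k$ bimatrix game is a pair $(R,C)$ of $k\times k$ matrices: $R$ gives the payoffs of the row player and $C$ those of the column player; all payoffs are assumed to lie in $[0,1]$. A mixed strategy is a probability distribution over $[k]=\{1,\dots,k\}$. Under a mixed strategy profile $(\mathbf x,\mathbf y)$ the row player's regret is $\max_{j\in[k]}(R_j\cdot\mathbf y)-\mathbf x\cdot R\cdot\mathbf y$ and the column player's regret is $\max_{j\in[k]}(\mathbf x\cdot C)_j-\mathbf x\cdot C\cdot\mathbf y$. The profile is an $\epsilon$-Nash equilibrium if both regrets are at most $\epsilon$. A payoff query selects a pure-strategy profile (row $r$, column $c$) and receives as response the payoffs $R_{r,c}$ and $C_{r,c}$. The number of payoff queries required (the payoff query complexity) is the smallest $N$ such that there is some algorithm that, given $N$ payoff queries to any game in the class (where initially none of the payoffs are known), can find a solution of the game. Queries may depend on the responses to previous queries, and no computational bound is imposed on the algorithm.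
   Formalization: The bound is stated for all k ≥ 2 (with one constant ε for all such k); for k = 1 the claim fails, since a 1×1 game has a unique profile and needs 0 payoff queries, which is not more than 2k−1 = 1. *)

theory Defs
  imports Complex_Main "HOL-Library.Extended_Nat" "Jordan_Normal_Form.Matrix"
begin

text \<open>
  Pure strategies are numbered \<open>0, \<dots>, k - 1\<close>, following the indexing of vectors and matrices
  in the library. A game is the pair of its payoff matrices (row player, column player).
\<close>

type_synonym bimatrix_game = "real mat \<times> real mat"
type_synonym strategy_profile = "real vec \<times> real vec"

definition bimatrix_games :: "nat \<Rightarrow> bimatrix_game set" where
  "bimatrix_games k = {(R, C). R \<in> carrier_mat k k \<and> C \<in> carrier_mat k k \<and>
     (\<forall>i<k. \<forall>j<k. R $$ (i, j) \<in> {0..1} \<and> C $$ (i, j) \<in> {0..1})}"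

definition mixed_strategies :: "nat \<Rightarrow> real vec set" where
  "mixed_strategies k = {x \<in> carrier_vec k. (\<forall>i<k. 0 \<le> x $ i) \<and> (\<Sum>i<k. x $ i) = 1}"

definition row_regret :: "nat \<Rightarrow> bimatrix_game \<Rightarrow> strategy_profile \<Rightarrow> real" where
  "row_regret k = (\<lambda>(R, C) (x, y). (MAX j\<in>{..<k}. row R j \<bullet> y) - x \<bullet> (R *\<^sub>v y))"

definition col_regret :: "nat \<Rightarrow> bimatrix_game \<Rightarrow> strategy_profile \<Rightarrow> real" where
  "col_regret k = (\<lambda>(R, C) (x, y). (MAX j\<in>{..<k}. x \<bullet> col C j) - x \<bullet> (C *\<^sub>v y))"

definition approx_nash :: "nat \<Rightarrow> real \<Rightarrow> bimatrix_game \<Rightarrow> strategy_profile \<Rightarrow> bool" where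
  "approx_nash k \<epsilon> G p \<longleftrightarrow> p \<in> mixed_strategies k \<times> mixed_strategies k \<and>
     row_regret k G p \<le> \<epsilon> \<and> col_regret k G p \<le> \<epsilon>"

text \<open>
  A deterministic adaptive query algorithm is a decision tree: \<open>Query r c f\<close> asks for the payoffs
  of the pure profile \<open>(r, c)\<close> and continues with \<open>f a b\<close>, where \<open>a\<close> and \<open>b\<close> are the row and the
  column player's payoff. The responses are all the algorithm learns about the game. Since \<open>f\<close> is
  an arbitrary function, no computational bound is imposed.
\<close>

datatype query_alg =
    Output strategy_profile
  | Query nat nat "real \<Rightarrow> real \<Rightarrow> query_alg"

primrec alg_output :: "bimatrix_game \<Rightarrow> query_alg \<Rightarrow> strategy_profile" where
  "alg_output G (Output p) = p"
| "alg_output G (Query r c f) = alg_output G (f (fst G $$ (r, c)) (snd G $$ (r, c)))"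

primrec alg_queries :: "bimatrix_game \<Rightarrow> query_alg \<Rightarrow> (nat \<times> nat) list" where
  "alg_queries G (Output p) = []"
| "alg_queries G (Query r c f) =
     (r, c) # alg_queries G (f (fst G $$ (r, c)) (snd G $$ (r, c)))"

definition finds_approx_nash :: "nat \<Rightarrow> real \<Rightarrow> nat \<Rightarrow> query_alg \<Rightarrow> bool" where
  "finds_approx_nash k \<epsilon> N A \<longleftrightarrow> (\<forall>G\<in>bimatrix_games k.
     set (alg_queries G A) \<subseteq> {..<k} \<times> {..<k} \<and>
     length (alg_queries G A) \<le> N \<and>
     approx_nash k \<epsilon> G (alg_output G A))"

text \<open>
  The infimum in \<^typ>\<open>enat\<close> is the least such \<open>N\<close> whenever one exists (\<open>k\<^sup>2\<close> queries reveal the whole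
  game); using it avoids an unspecified value of \<open>LEAST\<close>.
\<close>

definition payoff_query_complexity :: "nat \<Rightarrow> real \<Rightarrow> enat" where
  "payoff_query_complexity k \<epsilon> = Inf {enat N | N. \<exists>A. finds_approx_nash k \<epsilon> N A}"

end

theory Submission
  imports Defs
begin

text \<open>
  The adversary answers a query at \<open>(i, c)\<close> with \<open>(1, 0)\<close> if \<open>i + c\<close> is even and with \<open>(0, 1)\<close>
  otherwise. Let \<open>(x, y)\<close> be the output and let \<open>v\<close> and \<open>w\<close> be the payoffs of the two players from
  the queried cells. Completing the game so that the row player gets \<open>1\<close> at the unqueried cells of
  a single row and \<open>0\<close> at all others shows that, up to \<open>\<epsilon>\<close>, every row
  contains queried zeros of \<open>y\<close>-mass at least \<open>w\<close>; likewise every column contains queried ones of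
  \<open>x\<close>-mass at least \<open>v\<close>. If \<open>v, w > \<epsilon>\<close>, there are thus at least \<open>k\<close> queried zeros and \<open>k\<close> queried
  ones. Otherwise, since the ones of two adjacent columns lie in disjoint sets of rows, almost all
  mass is unqueried and hence sits at a single cell \<open>(r, s)\<close>; now a cell next to it in row \<open>r\<close> must
  be a one and a cell next to it in column \<open>s\<close> a zero, although these two have the same parity.
\<close>

text \<open>Agreement on the cells queried in \<open>G\<close> keeps the run on \<open>H\<close> in
  the same branch of the decision tree at every node, so both runs reach the same leaf.\<close>

lemma alg_output_cong:
  assumes "\<And>r c. (r, c) \<in> set (alg_queries G A) \<Longrightarrow>
    fst H $$ (r, c) = fst G $$ (r, c) \<and> snd H $$ (r, c) = snd G $$ (r, c)"
  shows "alg_output H A = alg_output G A"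
  using assms
proof (induction A)
  case (Query r c f)
  have "fst H $$ (r, c) = fst G $$ (r, c)" "snd H $$ (r, c) = snd G $$ (r, c)"
    using Query.prems by auto
  then show ?case
    using Query.IH[OF rangeI rangeI] Query.prems by simp
qed simp

section \<open>Mass estimates for probability vectors\<close>

text \<open>Averaging \<open>cover\<close> with weights \<open>x i\<close> gives \<open>a\<close>
  \<le> \<open>b\<close> plus the sum of \<open>x i * x i\<close>, and that sum of squares is at
  most the largest \<open>x i\<close>.\<close>

lemma exists_heavy_index:
  fixes x U Z :: "nat \<Rightarrow> real"
  assumes x: "\<And>i. i < k \<Longrightarrow> 0 \<le> x i" "(\<Sum>i<k. x i) = 1"
    and U: "\<And>i. i < k \<Longrightarrow> U i \<le> 1"
    and cover: "\<And>i. i < k \<Longrightarrow> a \<le> Z i + x i * U i"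
    and small: "(\<Sum>i<k. x i * Z i) \<le> b"
  shows "\<exists>r<k. a - b \<le> x r"
proof -
  have "{..<k} \<noteq> {}"
    using x(2) by auto
  then have "Max (x ` {..<k}) \<in> x ` {..<k}"
    by (intro Max_in) auto
  then obtain r where r: "r < k" "x r = Max (x ` {..<k})"
    by auto
  then have le: "x i \<le> x r" if "i < k" for i
    using that by simp
  have "a = (\<Sum>i<k. x i * a)"
    using x(2) by (simp flip: sum_distrib_right)
  also have "\<dots> \<le> (\<Sum>i<k. x i * Z i + x i * x r)"
  proof (rule sum_mono)
    fix i assume "i \<in> {..<k}"
    then have i: "i < k" by simp
    have "a \<le> Z i + x r"
      using cover[OF i] mult_left_mono[OF U[OF i] x(1)[OF i]] le[OF i] by simp
    then have "x i * a \<le> x i * (Z i + x r)"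
      using x(1)[OF i] by (rule mult_left_mono)
    then show "x i * a \<le> x i * Z i + x i * x r"
      by (simp add: algebra_simps)
  qed
  also have "\<dots> = (\<Sum>i<k. x i * Z i) + x r"
    using x(2) by (simp add: sum.distrib flip: sum_distrib_right)
  finally show ?thesis
    using small r(1) by (intro exI[of _ r]) simp
qed

lemma sum_of_bool_nonzeroD:
  fixes x :: "nat \<Rightarrow> real"
  assumes "0 < (\<Sum>i<k. x i * of_bool (P i))"
  shows "\<exists>i<k. P i"
proof (rule ccontr)
  assume "\<not> ?thesis"
  then have "(\<Sum>i<k. x i * of_bool (P i)) = 0"
    by (intro sum.neutral) auto
  with assms show False by simp
qed

text \<open>If \<open>P r\<close> failed, \<open>x r\<close> and the mass of \<open>P\<close> would
  come from disjoint sets of indices and add up to at most 1.\<close>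

lemma heavy_index_in_support:
  fixes x :: "nat \<Rightarrow> real"
  assumes "\<And>i. i < k \<Longrightarrow> 0 \<le> x i" "(\<Sum>i<k. x i) = 1" "r < k"
    and "1 < x r + (\<Sum>i<k. x i * of_bool (P i))"
  shows "P r"
proof (rule ccontr)
  assume "\<not> P r"
  then have "x r + (\<Sum>i<k. x i * of_bool (P i)) = x r + (\<Sum>i\<in>{..<k} - {r}. x i * of_bool (P i))"
    using \<open>r < k\<close> by (subst sum.remove[of _ r]) simp_all
  also have "\<dots> \<le> x r + (\<Sum>i\<in>{..<k} - {r}. x i)"
    using assms(1) by (intro add_left_mono sum_mono) auto
  also have "\<dots> = 1"
    using assms(2) \<open>r < k\<close> by (simp add: sum.remove[of _ r])
  finally show False using assms(4) by simp
qed

lemma sum_two_le: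
  fixes f :: "nat \<Rightarrow> real"
  assumes "\<And>i. i < k \<Longrightarrow> 0 \<le> f i" "a < k" "b < k" "a \<noteq> b"
  shows "f a + f b \<le> (\<Sum>i<k. f i)"
proof -
  have "f a + f b = sum f {a, b}" using assms(4) by simp
  also have "\<dots> \<le> (\<Sum>i<k. f i)" using assms by (intro sum_mono2) auto
  finally show ?thesis .
qed

lemma disjoint_masses_le:
  fixes x :: "nat \<Rightarrow> real"
  assumes "\<And>i. i < k \<Longrightarrow> 0 \<le> x i" "(\<Sum>i<k. x i) = 1" "\<And>i. i < k \<Longrightarrow> \<not> (P i \<and> P' i)"
  shows "(\<Sum>i<k. x i * of_bool (P i)) + (\<Sum>i<k. x i * of_bool (P' i)) \<le> 1"
proof -
  have "(\<Sum>i<k. x i * of_bool (P i)) + (\<Sum>i<k. x i * of_bool (P' i)) \<le> (\<Sum>i<k. x i)"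
    unfolding sum.distrib[symmetric] using assms(1,3) by (intro sum_mono) auto
  with assms(2) show ?thesis by simp
qed

lemma exists_neighbour:
  assumes "2 \<le> k" "s < (k::nat)"
  shows "\<exists>s'<k. s' \<noteq> s \<and> (even s' \<longleftrightarrow> odd s)"
  using assms by (intro exI[of _ "if s = 0 then 1 else s - 1"]) auto

section \<open>Counting queried cells of the checkerboard\<close>

text \<open>Here \<open>W c\<close> and \<open>Z i\<close> are the masses of queried ones in column
  \<open>c\<close> and queried zeros in row \<open>i\<close>; \<open>T\<close> and \<open>U\<close>
  are the unqueried masses. \<open>row\<close> and \<open>col\<close> are the inequalities that
  small regret in every completion forces.\<close>

lemma checkerboard_queries:
  fixes x y :: "nat \<Rightarrow> real" and Q :: "(nat \<times> nat) set"
  assumes k: "2 \<le> k"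
    and x: "\<And>i. i < k \<Longrightarrow> 0 \<le> x i" "(\<Sum>i<k. x i) = 1"
    and y: "\<And>i. i < k \<Longrightarrow> 0 \<le> y i" "(\<Sum>i<k. y i) = 1"
    and Q: "finite Q"
  defines "W \<equiv> \<lambda>c. \<Sum>i<k. x i * of_bool ((i, c) \<in> Q \<and> even (i + c))"
    and "T \<equiv> \<lambda>c. \<Sum>i<k. x i * of_bool ((i, c) \<notin> Q)"
    and "Z \<equiv> \<lambda>i. \<Sum>c<k. y c * of_bool ((i, c) \<in> Q \<and> odd (i + c))"
    and "U \<equiv> \<lambda>i. \<Sum>c<k. y c * of_bool ((i, c) \<notin> Q)"
  defines "v \<equiv> \<Sum>c<k. y c * W c" and "w \<equiv> \<Sum>i<k. x i * Z i"
  assumes row: "\<And>i. i < k \<Longrightarrow> 1 - v - 1/24 \<le> Z i + x i * U i"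
    and col: "\<And>c. c < k \<Longrightarrow> 1 - w - 1/24 \<le> W c + y c * T c"
  shows "2 * k \<le> card Q"
proof -
  have T_bounds: "0 \<le> T c" "T c \<le> 1" for c
  proof -
    show "0 \<le> T c" unfolding T_def using x(1) by (intro sum_nonneg) auto
    have "T c \<le> (\<Sum>i<k. x i)" unfolding T_def using x(1) by (intro sum_mono) auto
    then show "T c \<le> 1" using x(2) by simp
  qed
  have U_bounds: "0 \<le> U c" "U c \<le> 1" for c
  proof -
    show "0 \<le> U c" unfolding U_def using y(1) by (intro sum_nonneg) auto
    have "U c \<le> (\<Sum>i<k. y i)" unfolding U_def using y(1) by (intro sum_mono) auto
    then show "U c \<le> 1" using y(2) by simp
  qed
  have v0: "0 \<le> v" unfolding v_def W_def using x y by (intro sum_nonneg mult_nonneg_nonneg) auto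
  have w0: "0 \<le> w" unfolding w_def Z_def using x y by (intro sum_nonneg mult_nonneg_nonneg) auto
  have xU_yT: "(\<Sum>i<k. x i * U i) = (\<Sum>c<k. y c * T c)"
    unfolding U_def T_def sum_distrib_left by (subst sum.swap) (simp add: ac_simps)
  have v_swap: "v = (\<Sum>i<k. x i * (\<Sum>c<k. y c * of_bool ((i, c) \<in> Q \<and> even (i + c))))"
    unfolding v_def W_def sum_distrib_left by (subst sum.swap) (simp add: ac_simps)
  \<comment> \<open>Queried even, queried odd and unqueried cells partition the board, so their
    masses under the product of \<open>x\<close> and \<open>y\<close> sum to 1.\<close>
  have "v + w + (\<Sum>i<k. x i * U i) = (\<Sum>i<k. x i * (\<Sum>c<k. y c))"
    unfolding v_swap w_def Z_def U_def sum.distrib[symmetric] distrib_left[symmetric]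
    by (intro sum.cong refl arg_cong2[of _ _ _ _ "(*)"]) auto
  then have total: "v + w + (\<Sum>i<k. x i * U i) = 1"
    using x y by simp
  have total': "v + w + (\<Sum>c<k. y c * T c) = 1"
    using total xU_yT by simp
  show ?thesis
  proof (cases "v > 1/24 \<and> w > 1/24")
    case True
    have "\<exists>c. (i, c) \<in> Q \<and> odd (i + c)" if i: "i < k" for i
    proof -
      have "x i * U i \<le> (\<Sum>i<k. x i * U i)"
        using member_le_sum[of i "{..<k}" "\<lambda>i. x i * U i"] x(1) U_bounds(1) i by auto
      \<comment> \<open>Since \<open>x i * U i\<close> is at most the unqueried mass
        \<open>1 - v - w\<close>, \<open>row\<close> leaves \<open>Z i\<close> \<ge>
        \<open>w - 1/24\<close>.\<close>
      then have "0 < Z i"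
        using row[OF i] total True by linarith
      then show ?thesis unfolding Z_def by - (drule sum_of_bool_nonzeroD, auto)
    qed
    then have "{..<k} \<subseteq> fst ` {p \<in> Q. odd (fst p + snd p)}"
      by (force simp: image_iff)
    then have zeros: "k \<le> card {p \<in> Q. odd (fst p + snd p)}"
      using surj_card_le[of "{p \<in> Q. odd (fst p + snd p)}" "{..<k}" fst] Q by simp
    have "\<exists>i. (i, c) \<in> Q \<and> even (i + c)" if c: "c < k" for c
    proof -
      have "y c * T c \<le> (\<Sum>c<k. y c * T c)"
        using member_le_sum[of c "{..<k}" "\<lambda>c. y c * T c"] y(1) T_bounds(1) c by auto
      then have "0 < W c"
        using col[OF c] total' True by linarith
      then show ?thesis unfolding W_def by - (drule sum_of_bool_nonzeroD, auto)
    qed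
    then have "{..<k} \<subseteq> snd ` {p \<in> Q. even (fst p + snd p)}"
      by (force simp: image_iff)
    then have ones: "k \<le> card {p \<in> Q. even (fst p + snd p)}"
      using surj_card_le[of "{p \<in> Q. even (fst p + snd p)}" "{..<k}" snd] Q by simp
    have "card Q = card ({p \<in> Q. odd (fst p + snd p)} \<union> {p \<in> Q. even (fst p + snd p)})"
      by (rule arg_cong[of _ _ card]) auto
    also have "\<dots> = card {p \<in> Q. odd (fst p + snd p)} + card {p \<in> Q. even (fst p + snd p)}"
      using Q by (intro card_Un_disjoint) auto
    finally show ?thesis using zeros ones by simp
  next
    case False
    \<comment> \<open>If \<open>w\<close> \<le> 1/24, adding \<open>col\<close> for columns 0 and 1
      gives \<open>2 - 2 * w - 2/24\<close> \<le> \<open>1 + (1 - v - w)\<close>, hence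
      \<open>v\<close> \<le> \<open>w + 2/24\<close> \<le> 3/24. The other case uses rows 0 and
      1.\<close>
    have vw: "v + w \<le> 4/24"
    proof (cases "w \<le> 1/24")
      case True
      have "W 0 + W 1 \<le> 1"
        unfolding W_def using x by (intro disjoint_masses_le) auto
      moreover have "y 0 * T 0 + y 1 * T 1 \<le> (\<Sum>c<k. y c * T c)"
        using k y(1) T_bounds(1) by (intro sum_two_le) auto
      ultimately show ?thesis
        using col[of 0] col[of 1] k True total' by simp
    next
      case w: False
      have "Z 0 + Z 1 \<le> 1"
        unfolding Z_def using y by (intro disjoint_masses_le) auto
      moreover have "x 0 * U 0 + x 1 * U 1 \<le> (\<Sum>i<k. x i * U i)"
        using k x(1) U_bounds(1) by (intro sum_two_le) auto
      ultimately show ?thesis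
        using row[of 0] row[of 1] k w False total by simp
    qed
    have row': "19/24 \<le> Z i + x i * U i" if "i < k" for i
      using row[OF that] vw w0 by simp
    have col': "19/24 \<le> W c + y c * T c" if "c < k" for c
      using col[OF that] vw v0 by simp
    have "\<exists>r<k. 19/24 - 4/24 \<le> x r"
      using vw v0 by (intro exists_heavy_index[OF x U_bounds(2) row']) (auto simp: w_def)
    then obtain r where r: "r < k" "15/24 \<le> x r" by auto
    have "\<exists>s<k. 19/24 - 4/24 \<le> y s"
      using vw w0 by (intro exists_heavy_index[OF y T_bounds(2) col']) (auto simp: v_def)
    then obtain s where s: "s < k" "15/24 \<le> y s" by auto
    obtain r' where r': "r' < k" "r' \<noteq> r" "even r' \<longleftrightarrow> odd r"
      using exists_neighbour[OF k r(1)] by auto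
    obtain s' where s': "s' < k" "s' \<noteq> s" "even s' \<longleftrightarrow> odd s"
      using exists_neighbour[OF k s(1)] by auto
    have "x r + x r' \<le> 1"
      using sum_two_le[of k x r r'] r(1) r'(1,2) x by simp
    moreover have "x r' * U r' \<le> x r'"
      using mult_left_mono[OF U_bounds(2)[of r'] x(1)[OF r'(1)]] by simp
    \<comment> \<open>As \<open>x r'\<close> \<le> 9/24, \<open>Z r'\<close> \<ge> 10/24, and the
      sum is at least 25/24. With \<epsilon> in place of 1/24 the same chain gives
      \<open>2 - 23 * \<epsilon>\<close>, which exceeds 1 exactly when \<epsilon> < 1/23.\<close>
    ultimately have "1 < y s + Z r'"
      using row'[OF r'(1)] r(2) s(2) by simp
    then have zero: "(r', s) \<in> Q \<and> odd (r' + s)"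
      using heavy_index_in_support[OF y s(1), of "\<lambda>c. (r', c) \<in> Q \<and> odd (r' + c)"]
      by (simp add: Z_def)
    have "y s + y s' \<le> 1"
      using sum_two_le[of k y s s'] s(1) s'(1,2) y by simp
    moreover have "y s' * T s' \<le> y s'"
      using mult_left_mono[OF T_bounds(2)[of s'] y(1)[OF s'(1)]] by simp
    ultimately have "1 < x r + W s'"
      using col'[OF s'(1)] r(2) s(2) by simp
    then have "(r, s') \<in> Q \<and> even (r + s')"
      using heavy_index_in_support[OF x r(1), of "\<lambda>i. (i, s') \<in> Q \<and> even (i + s')"]
      by (simp add: W_def)
    then show ?thesis
      using zero r'(3) s'(3) by auto
  qed
qed

section \<open>Regrets in the completed games\<close>

text \<open>The row player's matrix depends only on \<open>j\<close> and the column player's only on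
  \<open>l\<close>, so one family tests both regrets.\<close>

definition completion :: "nat \<Rightarrow> (nat \<times> nat) set \<Rightarrow> nat \<Rightarrow> nat \<Rightarrow> bimatrix_game" where
  "completion k Q j l =
     (mat k k (\<lambda>(i, c). of_bool (if (i, c) \<in> Q then even (i + c) else i = j)),
      mat k k (\<lambda>(i, c). of_bool (if (i, c) \<in> Q then odd (i + c) else c = l)))"

lemma completion_in_bimatrix_games: "completion k Q j l \<in> bimatrix_games k"
  by (auto simp: completion_def bimatrix_games_def)

text \<open>The bound comes from deviating to row \<open>j\<close>, which pays 1 except at its
  queried zeros. The profile itself earns the queried ones plus the unqueried mass of row
  \<open>j\<close>.\<close>

lemma row_regret_completion:
  assumes x: "x \<in> mixed_strategies k" and y: "y \<in> mixed_strategies k" and j: "j < k"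
  shows "1 - (\<Sum>c<k. y $ c * of_bool ((j, c) \<in> Q \<and> odd (j + c)))
      - (\<Sum>c<k. y $ c * (\<Sum>i<k. x $ i * of_bool ((i, c) \<in> Q \<and> even (i + c))))
      - x $ j * (\<Sum>c<k. y $ c * of_bool ((j, c) \<notin> Q))
    \<le> row_regret k (completion k Q j l) (x, y)"
proof -
  have dims: "dim_vec x = k" "dim_vec y = k" and y1: "(\<Sum>c<k. y $ c) = 1"
    using x y by (auto simp: mixed_strategies_def)
  let ?M = "mat k k (\<lambda>(i, c). of_bool (if (i, c) \<in> Q then even (i + c) else i = j)) :: real mat"
  have "row ?M j \<bullet> y \<le> (MAX j\<in>{..<k}. row ?M j \<bullet> y)"
    using j by (intro Max_ge) auto
  moreover have "row ?M j \<bullet> y = (\<Sum>c<k. y $ c * of_bool (if (j, c) \<in> Q then even (j + c) else True))"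
    using j dims by (simp add: scalar_prod_def atLeast0LessThan mult.commute)
  moreover have "\<dots> + (\<Sum>c<k. y $ c * of_bool ((j, c) \<in> Q \<and> odd (j + c))) = (\<Sum>c<k. y $ c)"
    unfolding sum.distrib[symmetric] by (intro sum.cong) auto
  moreover have "x \<bullet> (?M *\<^sub>v y) = (\<Sum>i<k. \<Sum>c<k. x $ i * (y $ c * of_bool (if (i, c) \<in> Q then even (i + c) else i = j)))"
    using dims by (simp add: scalar_prod_def atLeast0LessThan sum_distrib_left ac_simps
        del: sum_mult_of_bool_eq sum_of_bool_mult_eq)
  moreover have "\<dots> = (\<Sum>i<k. \<Sum>c<k. x $ i * (y $ c * of_bool ((i, c) \<in> Q \<and> even (i + c))))
      + (\<Sum>i<k. \<Sum>c<k. of_bool (i = j) * (x $ i * (y $ c * of_bool ((i, c) \<notin> Q))))"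
    unfolding sum.distrib[symmetric] by (intro sum.cong refl) auto
  moreover have "(\<Sum>i<k. \<Sum>c<k. of_bool (i = j) * (x $ i * (y $ c * of_bool ((i, c) \<notin> Q))))
      = x $ j * (\<Sum>c<k. y $ c * of_bool ((j, c) \<notin> Q))"
    \<comment> \<open>After the swap \<open>i\<close> is the inner index, so the indicator of
      \<open>i = j\<close> collapses the inner sum.\<close>
    using j by (subst sum.swap)
      (simp add: sum_distrib_left of_bool_def if_distrib[of "\<lambda>b. b * _"] cong: if_cong)
  moreover have "(\<Sum>i<k. \<Sum>c<k. x $ i * (y $ c * of_bool ((i, c) \<in> Q \<and> even (i + c))))
      = (\<Sum>c<k. y $ c * (\<Sum>i<k. x $ i * of_bool ((i, c) \<in> Q \<and> even (i + c))))"
    unfolding sum_distrib_left by (subst sum.swap) (simp add: ac_simps)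
  ultimately show ?thesis
    using y1 unfolding row_regret_def completion_def prod.case by linarith
qed

text \<open>Mirror image: the deviation is to column \<open>l\<close>, where the column player's
  zeros are the queried even cells.\<close>

lemma col_regret_completion:
  assumes x: "x \<in> mixed_strategies k" and y: "y \<in> mixed_strategies k" and l: "l < k"
  shows "1 - (\<Sum>i<k. x $ i * of_bool ((i, l) \<in> Q \<and> even (i + l)))
      - (\<Sum>i<k. x $ i * (\<Sum>c<k. y $ c * of_bool ((i, c) \<in> Q \<and> odd (i + c))))
      - y $ l * (\<Sum>i<k. x $ i * of_bool ((i, l) \<notin> Q))
    \<le> col_regret k (completion k Q j l) (x, y)"
proof -
  have dims: "dim_vec x = k" "dim_vec y = k" and x1: "(\<Sum>i<k. x $ i) = 1"
    using x y by (auto simp: mixed_strategies_def)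
  let ?M = "mat k k (\<lambda>(i, c). of_bool (if (i, c) \<in> Q then odd (i + c) else c = l)) :: real mat"
  have "x \<bullet> col ?M l \<le> (MAX l\<in>{..<k}. x \<bullet> col ?M l)"
    using l by (intro Max_ge) auto
  moreover have "x \<bullet> col ?M l = (\<Sum>i<k. x $ i * of_bool (if (i, l) \<in> Q then odd (i + l) else True))"
    using l dims by (simp add: scalar_prod_def atLeast0LessThan)
  moreover have "\<dots> + (\<Sum>i<k. x $ i * of_bool ((i, l) \<in> Q \<and> even (i + l))) = (\<Sum>i<k. x $ i)"
    unfolding sum.distrib[symmetric] by (intro sum.cong) auto
  moreover have "x \<bullet> (?M *\<^sub>v y) = (\<Sum>i<k. \<Sum>c<k. x $ i * (y $ c * of_bool (if (i, c) \<in> Q then odd (i + c) else c = l)))"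
    using dims by (simp add: scalar_prod_def atLeast0LessThan sum_distrib_left ac_simps
        del: sum_mult_of_bool_eq sum_of_bool_mult_eq)
  moreover have "\<dots> = (\<Sum>i<k. \<Sum>c<k. x $ i * (y $ c * of_bool ((i, c) \<in> Q \<and> odd (i + c))))
      + (\<Sum>i<k. \<Sum>c<k. of_bool (c = l) * (y $ c * (x $ i * of_bool ((i, c) \<notin> Q))))"
    unfolding sum.distrib[symmetric] by (intro sum.cong refl) auto
  moreover have "(\<Sum>i<k. \<Sum>c<k. of_bool (c = l) * (y $ c * (x $ i * of_bool ((i, c) \<notin> Q))))
      = y $ l * (\<Sum>i<k. x $ i * of_bool ((i, l) \<notin> Q))"
    using l by (simp add: sum_distrib_left of_bool_def if_distrib[of "\<lambda>b. b * _"] cong: if_cong)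
  moreover have "(\<Sum>i<k. \<Sum>c<k. x $ i * (y $ c * of_bool ((i, c) \<in> Q \<and> odd (i + c))))
      = (\<Sum>i<k. x $ i * (\<Sum>c<k. y $ c * of_bool ((i, c) \<in> Q \<and> odd (i + c))))"
    unfolding sum_distrib_left ..
  ultimately show ?thesis
    using x1 unfolding col_regret_def completion_def prod.case by linarith
qed

lemma finds_approx_nash_imp_queries:
  assumes k: "2 \<le> k" and A: "finds_approx_nash k (1/24) N A"
  shows "2 * k \<le> N"
proof -
  \<comment> \<open>With every cell in the set this is the full checkerboard: the adversary's
    answers are fixed in advance by one game. The indices 0 are arbitrary.\<close>
  define G where "G = completion k ({..<k} \<times> {..<k}) 0 0"
  define Q where "Q = set (alg_queries G A)"
  obtain x y where xy: "alg_output G A = (x, y)" by fastforce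
  have G: "G \<in> bimatrix_games k"
    unfolding G_def by (rule completion_in_bimatrix_games)
  have Q: "Q \<subseteq> {..<k} \<times> {..<k}" "length (alg_queries G A) \<le> N"
    and nash: "approx_nash k (1/24) G (x, y)"
    using A G xy unfolding finds_approx_nash_def Q_def by metis+
  have xm: "x \<in> mixed_strategies k" and ym: "y \<in> mixed_strategies k"
    using nash by (auto simp: approx_nash_def)
  have "alg_output (completion k Q j l) A = (x, y)" for j l
    unfolding xy[symmetric]
  proof (rule alg_output_cong)
    fix r c assume "(r, c) \<in> set (alg_queries G A)"
    then have "(r, c) \<in> Q" "r < k" "c < k"
      using Q(1) by (auto simp: Q_def)
    then show "fst (completion k Q j l) $$ (r, c) = fst G $$ (r, c) \<and>
        snd (completion k Q j l) $$ (r, c) = snd G $$ (r, c)"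
      by (simp add: completion_def G_def)
  qed
  \<comment> \<open>The algorithm cannot tell the completions apart, so the single profile
    \<open>(x, y)\<close> must be an approximate equilibrium of all of them at once.\<close>
  then have regret: "row_regret k (completion k Q j l) (x, y) \<le> 1/24"
    "col_regret k (completion k Q j l) (x, y) \<le> 1/24" for j l
    using A completion_in_bimatrix_games[of k Q j l]
    unfolding finds_approx_nash_def approx_nash_def by metis+
  have "2 * k \<le> card Q"
  proof (rule checkerboard_queries[OF k, of "($) x" "($) y"])
    fix i assume i: "i < k"
    show "1 - (\<Sum>c<k. y $ c * (\<Sum>i<k. x $ i * of_bool ((i, c) \<in> Q \<and> even (i + c)))) - 1/24
      \<le> (\<Sum>c<k. y $ c * of_bool ((i, c) \<in> Q \<and> odd (i + c)))
        + x $ i * (\<Sum>c<k. y $ c * of_bool ((i, c) \<notin> Q))"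
      using row_regret_completion[OF xm ym i, of Q 0] regret(1)[of i 0] by linarith
    show "1 - (\<Sum>i<k. x $ i * (\<Sum>c<k. y $ c * of_bool ((i, c) \<in> Q \<and> odd (i + c)))) - 1/24
      \<le> (\<Sum>j<k. x $ j * of_bool ((j, i) \<in> Q \<and> even (j + i)))
        + y $ i * (\<Sum>j<k. x $ j * of_bool ((j, i) \<notin> Q))"
      using col_regret_completion[OF xm ym i, of Q 0] regret(2)[of 0 i] by linarith
  qed (use xm ym in \<open>auto simp: mixed_strategies_def Q_def\<close>)
  also have "card Q \<le> N"
    using Q(2) card_length[of "alg_queries G A"] unfolding Q_def by linarith
  finally show ?thesis .
qed

theorem corollary14:
  shows "\<exists>\<epsilon>::real. \<epsilon> > 0 \<and>
    (\<forall>k::nat. k \<ge> 2 \<longrightarrow> payoff_query_complexity k \<epsilon> > enat (2 * k - 1))"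
proof (intro exI[of _ "1/24"] conjI allI impI)
  fix k :: nat assume k: "k \<ge> 2"
  have "enat (2 * k) \<le> payoff_query_complexity k (1/24)"
    unfolding payoff_query_complexity_def
    using finds_approx_nash_imp_queries[OF k] by (auto intro!: Inf_greatest)
  moreover have "enat (2 * k - 1) < enat (2 * k)"
    using k by simp
  ultimately show "payoff_query_complexity k (1/24) > enat (2 * k - 1)"
    by (rule less_le_trans[rotated])
qed simp

end
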